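(* Let $C$ be a closed $C^2$ curve in the Euclidean plane $\mathbb R^2$ with non-vanishing curvature and total curvature $2k\pi$, where $k\in\mathbb N$, $k>0$, and let $0<\alpha<\pi$ be commensurable with $\pi$ (i.e. $\alpha/\pi\in\mathbb Q$). Then there exist $2k$ closed curves $K_i$, $i=0,\ldots,2k-1$, such that each $(K_i,C)$ is an equiangular Poncelet pair with angle $\alpha$.
   Context: Poncelet pair: Let $K$ and $C$ be closed curves in the Euclidean plane. If every point $Q\in K$ is a vertex of an $n$-gon $P$ inscribed in $K$ (all vertices of $P$ lie on $K$) and circumscribed about $C$, then $(K,C)$ is called a Poncelet pair and $P$ a Poncelet polygon; $K$ is the vertex curve and $C$ the envelope. "Circumscribed" also allows that only the prolongations of the sides of $P$ are tangential to $C$, i.e. each side of $P$ lies on a tangent line of $C$. Equiangular: the Poncelet pair $(K,C)$ is called equiangular if the external angles of each Poncelet polygon are equal and independent of the starting point; their common value is the angle of the pair. The external angle at a vertex is the angle between the lines containing the two consecutive sides meeting there. As sides may touch $C$ through their prolongations, the external angle is understood modulo $\pi$, so turning angles $\alpha+i\pi$, $i\in\mathbb Z$, all count as external angle $\alpha$. *)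

theory Defs
  imports "HOL-Analysis.Analysis"
begin

text \<open>
  The Euclidean plane is the type of complex numbers. The envelope is given by a regular
  parametrisation on the whole real line with period \<open>L\<close>, so that it closes up to second order.
\<close>

definition velocity :: "(real \<Rightarrow> complex) \<Rightarrow> real \<Rightarrow> complex" where
  "velocity c t = vector_derivative c (at t)"

definition acceleration :: "(real \<Rightarrow> complex) \<Rightarrow> real \<Rightarrow> complex" where
  "acceleration c t = vector_derivative (velocity c) (at t)"

definition closed_C2_curve :: "real \<Rightarrow> (real \<Rightarrow> complex) \<Rightarrow> bool" where
  "closed_C2_curve L c \<longleftrightarrow>
     L > 0 \<and> (\<forall>t. c (t + L) = c t) \<and>
     (\<forall>t. c differentiable (at t)) \<and> (\<forall>t. velocity c differentiable (at t)) \<and>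
     continuous_on UNIV (acceleration c) \<and> (\<forall>t. velocity c t \<noteq> 0)"

text \<open>Signed curvature \<open>det (c', c'') / |c'|\<^sup>3\<close>.\<close>

definition curvature :: "(real \<Rightarrow> complex) \<Rightarrow> real \<Rightarrow> real" where
  "curvature c t = Im (cnj (velocity c t) * acceleration c t) / norm (velocity c t) ^ 3"

text \<open>
  The total curvature is the integral of the absolute curvature with respect to arc length, so it
  does not depend on the orientation of the parametrisation.
\<close>

definition total_curvature :: "real \<Rightarrow> (real \<Rightarrow> complex) \<Rightarrow> real" where
  "total_curvature L c = (LBINT t=0..L. \<bar>curvature c t\<bar> * norm (velocity c t))"

text \<open>
  Signed angle by which the tangent direction turns along the curve from parameter \<open>a\<close> to
  parameter \<open>b\<close>; the integral is oriented, so \<open>b < a\<close> is allowed.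
\<close>

definition turning :: "(real \<Rightarrow> complex) \<Rightarrow> real \<Rightarrow> real \<Rightarrow> real" where
  "turning c a b = (LBINT t=a..b. curvature c t * norm (velocity c t))"

definition tangent_line :: "(real \<Rightarrow> complex) \<Rightarrow> real \<Rightarrow> complex set" where
  "tangent_line c t = {c t + of_real s * velocity c t | s. True}"

definition closed_curve :: "(real \<Rightarrow> complex) \<Rightarrow> bool" where
  "closed_curve K \<longleftrightarrow> path K \<and> pathfinish K = pathstart K \<and> \<not> K constant_on {0..1}"

text \<open>
  An \<open>n\<close>-gon is a pair \<open>(v, t)\<close> of sequences indexed cyclically modulo \<open>n\<close>: \<open>v j\<close> is a vertex, and
  the line containing the side from \<open>v j\<close> to \<open>v (j + 1)\<close> is the tangent at parameter \<open>t j\<close>.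
  The line is part of the data since a side of the polygon may have length zero
  (three successive tangents may be concurrent if the envelope is not simple). Degenerate
  polygons that run back and forth on the same tangents are excluded by requiring the \<open>n\<close> points of
  contact to be different points of the closed curve, that is, different parameters modulo \<open>L\<close>.
\<close>

definition circumscribed_ngon ::
    "nat \<Rightarrow> real \<Rightarrow> (real \<Rightarrow> complex) \<Rightarrow> (nat \<Rightarrow> complex) \<times> (nat \<Rightarrow> real) \<Rightarrow> bool" where
  "circumscribed_ngon n L c = (\<lambda>(v, t).
     n \<ge> 3 \<and> (\<forall>j. v (j + n) = v j) \<and> (\<forall>j. (t (j + n) - t j) / L \<in> \<int>) \<and>
     (\<forall>i<n. \<forall>j<n. i \<noteq> j \<longrightarrow> (t i - t j) / L \<notin> \<int>) \<and>
     (\<forall>j. closed_segment (v j) (v (Suc j)) \<subseteq> tangent_line c (t j)))"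

definition inscribed :: "(real \<Rightarrow> complex) \<Rightarrow> (nat \<Rightarrow> complex) \<times> (nat \<Rightarrow> real) \<Rightarrow> bool" where
  "inscribed K = (\<lambda>(v, t). range v \<subseteq> path_image K)"

text \<open>
  \<open>\<P>\<close> is the collection of Poncelet polygons witnessing that \<open>(K, c)\<close> is a Poncelet pair.
\<close>

definition poncelet_polygons ::
    "nat \<Rightarrow> real \<Rightarrow> (real \<Rightarrow> complex) \<Rightarrow> (real \<Rightarrow> complex)
      \<Rightarrow> ((nat \<Rightarrow> complex) \<times> (nat \<Rightarrow> real)) set \<Rightarrow> bool" where
  "poncelet_polygons n L c K \<P> \<longleftrightarrow>
     (\<forall>P\<in>\<P>. inscribed K P \<and> circumscribed_ngon n L c P) \<and>
     (\<forall>Q\<in>path_image K. \<exists>(v, t)\<in>\<P>. Q \<in> range v)"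

text \<open>
  The directed angle from a line with direction \<open>u\<close> to a line with direction \<open>w\<close> is the angle from
  \<open>u\<close> to \<open>w\<close>, which is determined modulo \<open>\<pi>\<close>.
\<close>

definition has_external_angle :: "complex \<Rightarrow> complex \<Rightarrow> real \<Rightarrow> bool" where
  "has_external_angle u w \<alpha> \<longleftrightarrow> (\<exists>m::int. Arg (w / u) = \<alpha> + of_int m * pi)"

definition equiangular_poncelet_pair ::
    "real \<Rightarrow> (real \<Rightarrow> complex) \<Rightarrow> (real \<Rightarrow> complex) \<Rightarrow> real \<Rightarrow> bool" where
  "equiangular_poncelet_pair L c K \<alpha> \<longleftrightarrow>
     (\<exists>n \<P>. poncelet_polygons n L c K \<P> \<and>
       (\<forall>(v, t)\<in>\<P>. \<forall>j. has_external_angle (velocity c (t j)) (velocity c (t (Suc j))) \<alpha>))"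

text \<open>
  The refinement of the previous notion that does not reduce angles modulo \<open>\<pi>\<close>: the tangent of the
  envelope turns by exactly \<open>\<beta>\<close> between successive points of contact. The parameters \<open>t j\<close> are only
  determined modulo \<open>L\<close>, and each choice of lifts makes \<open>turning\<close> definite.
\<close>

definition poncelet_pair_with_turning ::
    "real \<Rightarrow> (real \<Rightarrow> complex) \<Rightarrow> (real \<Rightarrow> complex) \<Rightarrow> real \<Rightarrow> bool" where
  "poncelet_pair_with_turning L c K \<beta> \<longleftrightarrow>
     (\<exists>n \<P>. poncelet_polygons n L c K \<P> \<and>
       (\<forall>(v, t)\<in>\<P>. \<forall>j. turning c (t j) (t (Suc j)) = \<beta>))"

end

theory Submission
  imports Defs "HOL-Library.Periodic_Fun"
begin

text \<open>
  Since the curvature never vanishes, the tangent of the envelope turns monotonically, so the angle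
  \<open>\<phi>\<close> of the tangent, counted on the whole real line, can serve as parameter of the envelope. In
  this parameter the envelope has period \<open>T = 2k\<pi>\<close>, its total curvature (\<open>angle_parametrisation\<close>).
  Fix \<open>\<beta> = \<alpha> + i\<pi>\<close>. It is not a multiple of \<open>\<pi>\<close>, so the tangents at \<open>\<phi>\<close> and \<open>\<phi> + \<beta>\<close> are never
  parallel. Their intersection \<open>F \<phi>\<close> depends continuously on \<open>\<phi>\<close> and has period \<open>T\<close>; hence it
  describes a closed curve, the vertex curve \<open>K\<close>.

  Starting at any \<open>\<phi>\<close>, the tangents at \<open>\<phi>, \<phi> + \<beta>, \<phi> + 2\<beta>, \<dots>\<close> are the sides of a polygon with all
  its vertices on \<open>K\<close>, and every point of \<open>K\<close> is a vertex of such a polygon. It closes up because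
  \<open>\<beta> / T\<close> is rational. If \<open>n\<close> is the least positive integer with \<open>n\<beta> \<in> T\<int>\<close>, then the \<open>n\<close> points of
  contact are distinct; and \<open>n \<ge> 3\<close>, since \<open>n \<le> 2\<close> would make \<open>\<beta>\<close> a multiple of \<open>T / 2 = k\<pi>\<close>
  (\<open>least_multiple_in_Ints\<close>). Finally, \<open>K\<close> is not a single point, because the tangents of a regular
  curve with non-vanishing curvature do not all pass through one point
  (\<open>tangents_not_concurrent\<close>).
\<close>

section \<open>Curves parametrised by the angle of their tangent\<close>

lemma closed_C2_curve_derivatives:
  assumes "closed_C2_curve L c"
  shows "(c has_vector_derivative velocity c t) (at t)"
    and "(velocity c has_vector_derivative acceleration c t) (at t)"
proof -
  have "c differentiable (at t)" "velocity c differentiable (at t)"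
    using assms by (auto simp: closed_C2_curve_def)
  then show "(c has_vector_derivative velocity c t) (at t)"
    and "(velocity c has_vector_derivative acceleration c t) (at t)"
    by (simp_all add: vector_derivative_works velocity_def[of c t] acceleration_def)
qed

lemma vector_derivative_periodic:
  fixes f :: "real \<Rightarrow> complex"
  assumes "\<And>t. f (t + p) = f t" and "\<And>t. f differentiable (at t)"
  shows "vector_derivative f (at (t + p)) = vector_derivative f (at t)"
proof -
  have "(f has_vector_derivative vector_derivative f (at (t + p))) (at (t + p))"
    using assms(2) by (simp add: vector_derivative_works)
  then have "((f \<circ> (\<lambda>x. x + p)) has_vector_derivative
      1 *\<^sub>R vector_derivative f (at (t + p))) (at t)"
    by (intro vector_diff_chain_at) (auto intro!: derivative_eq_intros)
  moreover have "f \<circ> (\<lambda>x. x + p) = f"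
    using assms(1) by (simp add: fun_eq_iff)
  ultimately show ?thesis
    by (simp add: vector_derivative_at)
qed

lemma closed_C2_curve_periodic:
  assumes "closed_C2_curve L c"
  shows "c (t + L) = c t" and "velocity c (t + L) = velocity c t"
    and "acceleration c (t + L) = acceleration c t"
proof -
  have p: "\<And>t. c (t + L) = c t" and d: "\<And>t. c differentiable (at t)"
    and dv: "\<And>t. velocity c differentiable (at t)"
    using assms by (auto simp: closed_C2_curve_def)
  show "c (t + L) = c t" by (fact p)
  have v: "\<And>t. velocity c (t + L) = velocity c t"
    using vector_derivative_periodic[OF p d] by (simp add: velocity_def[abs_def])
  show "velocity c (t + L) = velocity c t" by (fact v)
  show "acceleration c (t + L) = acceleration c t"
    using vector_derivative_periodic[OF v dv] by (simp add: acceleration_def[abs_def])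
qed

lemma continuous_antiderivative:
  fixes g :: "real \<Rightarrow> complex"
  assumes "continuous_on UNIV g"
  obtains G where "\<And>t. (G has_vector_derivative g t) (at t)"
proof -
  have "\<exists>F. \<forall>x. -\<infinity> < ereal x \<longrightarrow> ereal x < \<infinity> \<longrightarrow> (F has_vector_derivative g x) (at x)"
    by (rule einterval_antiderivative) (use assms in \<open>auto simp: continuous_on_eq_continuous_at\<close>)
  then show ?thesis using that by auto
qed

text \<open>
  The rate of turning is the imaginary part of the logarithmic derivative of the velocity. This
  is what relates \<open>turning\<close> and \<open>total_curvature\<close> to a complex logarithm of the velocity.
\<close>

lemma curvature_times_speed:
  "velocity c t \<noteq> 0 \<Longrightarrow>
     curvature c t * norm (velocity c t) = Im (acceleration c t / velocity c t)"
  by (subst complex_div_cnj)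
    (simp add: curvature_def mult.commute power2_eq_square power3_eq_cube flip: of_real_mult)

lemma continuous_curvature_times_speed:
  assumes "closed_C2_curve L c"
  shows "continuous_on A (\<lambda>t. curvature c t * norm (velocity c t))"
proof -
  have v0: "\<And>t. velocity c t \<noteq> 0" and ca: "continuous_on UNIV (acceleration c)"
    using assms by (auto simp: closed_C2_curve_def)
  have cv: "continuous_on UNIV (velocity c)"
    using closed_C2_curve_derivatives(2)[OF assms]
    by (intro continuous_at_imp_continuous_on) (auto intro: has_vector_derivative_continuous)
  have "continuous_on UNIV (\<lambda>t. Im (acceleration c t / velocity c t))"
    using v0 ca cv by (intro continuous_intros) auto
  then show ?thesis
    using continuous_on_subset by (auto simp: curvature_times_speed[OF v0])
qed

text \<open>
  A continuous choice of the argument of the velocity: if \<open>H\<close> is an antiderivative of \<open>c'' / c'\<close>,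
  then \<open>c' exp (- H)\<close> has derivative zero, so that \<open>c'\<close> is a constant multiple of \<open>exp H\<close>. The
  imaginary part of the logarithm is the tangent angle.
\<close>

lemma logarithm_of_velocity:
  assumes "closed_C2_curve L c"
  obtains G where "\<And>t. velocity c t = exp (G t)"
    and "\<And>t. (G has_vector_derivative acceleration c t / velocity c t) (at t)"
proof -
  have v0: "\<And>t. velocity c t \<noteq> 0" and ca: "continuous_on UNIV (acceleration c)"
    using assms by (auto simp: closed_C2_curve_def)
  note dv = closed_C2_curve_derivatives(2)[OF assms]
  have cv: "continuous_on UNIV (velocity c)"
    using dv by (intro continuous_at_imp_continuous_on) (auto intro: has_vector_derivative_continuous)
  have "continuous_on UNIV (\<lambda>t. acceleration c t / velocity c t)"
    using v0 ca cv by (intro continuous_intros) auto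
  then obtain H where H: "\<And>t. (H has_vector_derivative acceleration c t / velocity c t) (at t)"
    using continuous_antiderivative by blast
  have const: "((\<lambda>t. velocity c t * exp (- H t)) has_vector_derivative 0) (at t)" for t
  proof -
    have "((\<lambda>t. - H t) has_vector_derivative - (acceleration c t / velocity c t)) (at t)"
      using H by (rule has_vector_derivative_minus)
    then have "((exp \<circ> (\<lambda>t. - H t)) has_vector_derivative
        - (acceleration c t / velocity c t) * exp (- H t)) (at t)"
      by (rule field_vector_diff_chain_at) (rule DERIV_exp)
    then have "((\<lambda>t. exp (- H t)) has_vector_derivative
        - (acceleration c t / velocity c t) * exp (- H t)) (at t)"
      by (simp add: o_def)
    from has_vector_derivative_mult[OF dv this] show ?thesis
      using v0 by (simp add: field_simps)
  qed
  obtain w where w: "\<And>t. velocity c t * exp (- H t) = w"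
  proof (rule has_vector_derivative_zero_constant[of UNIV "\<lambda>t. velocity c t * exp (- H t)"])
    show "((\<lambda>t. velocity c t * exp (- H t)) has_vector_derivative 0) (at t)" for t
      by (rule const)
  qed auto
  have "w \<noteq> 0" using v0[of 0] by (simp flip: w[of 0])
  show ?thesis
  proof
    show "velocity c t = exp (H t + Ln w)" for t
    proof -
      have "velocity c t = (velocity c t * exp (- H t)) * exp (H t)"
        by (simp add: exp_minus)
      also have "\<dots> = exp (H t + Ln w)"
        using \<open>w \<noteq> 0\<close> by (simp add: w exp_add mult.commute)
      finally show ?thesis .
    qed
    show "((\<lambda>t. H t + Ln w) has_vector_derivative acceleration c t / velocity c t) (at t)" for t
      using H by (auto intro!: derivative_eq_intros)
  qed
qed

text \<open>
  The curvature is continuous and has no zero, so its sign is constant and the absolute value can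
  be taken outside the integral.
\<close>

lemma total_curvature_eq_abs_turning:
  assumes "closed_C2_curve L c" and "\<And>t. curvature c t \<noteq> 0"
  shows "total_curvature L c = \<bar>turning c 0 L\<bar>"
proof -
  define k where "k t = curvature c t * norm (velocity c t)" for t
  have L: "L > 0" and v0: "\<And>t. velocity c t \<noteq> 0"
    using assms by (auto simp: closed_C2_curve_def)
  have ck: "continuous_on A k" for A
    unfolding k_def using continuous_curvature_times_speed[OF assms(1)] .
  have k0: "k t \<noteq> 0" for t
    using assms(2) v0 by (simp add: k_def)
  have T: "total_curvature L c = (LBINT t=0..L. \<bar>k t\<bar>)"
    by (simp add: total_curvature_def k_def abs_mult)
  have "connected (range k)"
    using ck by (intro connected_continuous_image) auto
  then have "k a < 0 \<Longrightarrow> k b > 0 \<Longrightarrow> 0 \<in> range k" for a b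
    by (rule connectedD_interval[of "range k" "k a" "k b"]) auto
  then have "(\<forall>t. k t > 0) \<or> (\<forall>t. k t < 0)"
    using k0 by (metis linorder_neqE_linordered_idom rangeE)
  then show ?thesis
  proof
    assume p: "\<forall>t. k t > 0"
    have "(LBINT t=0..L. k t) \<ge> 0"
      using L p by (auto simp: interval_lebesgue_integral_def set_lebesgue_integral_def less_imp_le zero_ereal_def
          intro!: Bochner_Integration.integral_nonneg)
    moreover have "(\<lambda>t. \<bar>k t\<bar>) = k"
      using p by (simp add: fun_eq_iff abs_of_pos)
    ultimately show ?thesis
      using T by (simp add: turning_def zero_ereal_def flip: k_def)
  next
    assume p: "\<forall>t. k t < 0"
    have "(LBINT t=0..L. - k t) \<ge> 0"
      unfolding interval_lebesgue_integral_def set_lebesgue_integral_def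
      using L p by (auto simp: less_imp_le zero_ereal_def indicator_def
          simp del: Bochner_Integration.integral_minus intro!: Bochner_Integration.integral_nonneg)
    moreover have "(\<lambda>t. \<bar>k t\<bar>) = (\<lambda>t. - k t)"
      using p by (simp add: fun_eq_iff abs_of_neg)
    ultimately show ?thesis
      using T by (simp add: turning_def zero_ereal_def interval_lebesgue_integral_uminus flip: k_def)
  qed
qed

text \<open>
  The values at the multiples of \<open>L\<close> form an arithmetic progression with difference \<open>D\<close>, and the
  intermediate value theorem fills the gaps.
\<close>

lemma continuous_surj_of_quasiperiodic:
  fixes f :: "real \<Rightarrow> real"
  assumes cont: "continuous_on UNIV f" and period: "\<And>t. f (t + L) = f t + D" and "D \<noteq> 0"
  shows "surj f"
proof -
  have "f (of_int m * L) = f 0 + of_int m * D" for m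
  proof (induction m rule: int_induct[of _ 0])
    case (step1 i)
    then show ?case using period[of "of_int i * L"] by (simp add: algebra_simps)
  next
    case (step2 i)
    then show ?case using period[of "of_int (i - 1) * L"] by (simp add: algebra_simps)
  qed simp
  note at_periods = this
  have conn: "connected (range f)"
    using cont by (intro connected_continuous_image) auto
  have "y \<in> range f" for y
  proof -
    define m where "m = \<lfloor>(y - f 0) / D\<rfloor>"
    have "of_int m \<le> (y - f 0) / D" "(y - f 0) / D \<le> of_int (m + 1)"
      unfolding m_def by linarith+
    then have "f (of_int m * L) \<le> y \<and> y \<le> f (of_int (m + 1) * L) \<or>
        f (of_int (m + 1) * L) \<le> y \<and> y \<le> f (of_int m * L)"
      using \<open>D \<noteq> 0\<close> unfolding at_periods by (cases "D > 0") (auto simp: field_simps)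
    then show ?thesis
      using conn unfolding connected_iff_interval by (metis rangeI)
  qed
  then show ?thesis by auto
qed

text \<open>
  The tangent angle \<open>\<theta>\<close> is injective by Rolle's theorem, and it is surjective since it grows by
  \<open>D = \<plusminus> total_curvature L c\<close> over each period; \<open>s\<close> is its inverse. No orientation of the envelope
  is fixed: if the curvature is negative then \<open>s\<close> is decreasing, but it still turns the tangent
  by \<open>\<psi> - \<phi>\<close> from \<open>s \<phi>\<close> to \<open>s \<psi>\<close>. The last property says that \<open>s\<close> induces a bijection between angles
  modulo the total curvature and parameters modulo \<open>L\<close>, that is, points of the closed curve.
\<close>

lemma angle_parametrisation:
  assumes C2: "closed_C2_curve L c" and curv: "\<And>t. curvature c t \<noteq> 0"
  obtains s where "continuous_on UNIV s" and "surj s"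
    and "\<And>\<phi>. \<exists>r>0. velocity c (s \<phi>) = rcis r \<phi>"
    and "\<And>\<phi> \<psi>. turning c (s \<phi>) (s \<psi>) = \<psi> - \<phi>"
    and "\<And>\<phi> \<psi>. (s \<phi> - s \<psi>) / L \<in> \<int> \<longleftrightarrow> (\<phi> - \<psi>) / total_curvature L c \<in> \<int>"
proof -
  have L: "L > 0" and v0: "\<And>t. velocity c t \<noteq> 0"
    using C2 by (auto simp: closed_C2_curve_def)
  obtain G where G: "\<And>t. velocity c t = exp (G t)"
    and dG: "\<And>t. (G has_vector_derivative acceleration c t / velocity c t) (at t)"
    using logarithm_of_velocity[OF C2] by blast
  define \<theta> where "\<theta> t = Im (G t)" for t
  have d\<theta>: "(\<theta> has_real_derivative curvature c t * norm (velocity c t)) (at t)" for t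
    using bounded_linear.has_vector_derivative[OF bounded_linear_Im dG[of t]]
    by (simp add: \<theta>_def[abs_def] curvature_times_speed[OF v0] has_real_derivative_iff_has_vector_derivative)
  have turn: "turning c a b = \<theta> b - \<theta> a" for a b
    unfolding turning_def
    by (rule interval_integral_FTC_finite)
      (use d\<theta> in \<open>auto simp: has_real_derivative_iff_has_vector_derivative
         intro: continuous_curvature_times_speed[OF C2] has_vector_derivative_at_within\<close>)
  have cont: "isCont \<theta> t" for t
    using d\<theta> by (rule DERIV_isCont)
  have inj: "inj \<theta>"
  proof (rule linorder_injI)
    fix x y :: real assume "x < y"
    show "\<theta> x \<noteq> \<theta> y"
    proof
      assume "\<theta> x = \<theta> y"
      then obtain z where "(\<theta> has_real_derivative 0) (at z)"
        using Rolle[OF \<open>x < y\<close>] cont d\<theta>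
        by (metis continuous_at_imp_continuous_on real_differentiable_def DERIV_unique)
      then show False
        using DERIV_unique[OF d\<theta>] curv v0 by fastforce
    qed
  qed
  define D where "D = \<theta> L - \<theta> 0"
  have period: "\<theta> (t + L) = \<theta> t + D" for t
  proof -
    have "((\<lambda>t. \<theta> (t + L) - \<theta> t) has_real_derivative 0) (at t)" for t
    proof -
      have "curvature c (t + L) = curvature c t"
        using closed_C2_curve_periodic[OF C2] by (simp add: curvature_def)
      moreover have "velocity c (t + L) = velocity c t"
        by (rule closed_C2_curve_periodic[OF C2])
      ultimately have "((\<lambda>t. \<theta> (t + L)) has_real_derivative curvature c t * norm (velocity c t)) (at t)"
        using d\<theta>[of "t + L"] by (simp add: DERIV_shift)
      from DERIV_diff[OF this d\<theta>] show ?thesis by simp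
    qed
    then have "\<theta> (t + L) - \<theta> t = \<theta> (0 + L) - \<theta> 0"
      by (intro DERIV_isconst_all) blast
    then show ?thesis by (simp add: D_def)
  qed
  have tot: "total_curvature L c = \<bar>D\<bar>"
    by (simp add: total_curvature_eq_abs_turning[OF C2 curv] turn D_def)
  have "D \<noteq> 0"
    using inj L unfolding D_def by (metis eq_iff_diff_eq_0 injD less_irrefl)
  have surj: "surj \<theta>"
    using cont period \<open>D \<noteq> 0\<close>
    by (intro continuous_surj_of_quasiperiodic[of \<theta> L D] continuous_at_imp_continuous_on) auto
  have per_int: "\<theta> (t + of_int m * L) = \<theta> t + of_int m * D" for t m
  proof -
    \<comment> \<open>Subtracting the linear part turns the growth condition into genuine periodicity.\<close>
    interpret periodic_fun_simple "\<lambda>t. \<theta> t - t / L * D" L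
      by standard (use period L in \<open>auto simp: field_simps\<close>)
    have "(t + of_int m * L) / L = t / L + of_int m"
      using L by (simp add: field_simps)
    then show ?thesis using plus_of_int[of t m] by (simp add: algebra_simps)
  qed
  define s where "s = inv \<theta>"
  have \<theta>s: "\<theta> (s \<phi>) = \<phi>" for \<phi> using surj by (simp add: s_def surj_f_inv_f)
  have s\<theta>: "s (\<theta> t) = t" for t using inj by (simp add: s_def)
  show ?thesis
  proof
    have "isCont s (\<theta> t)" for t
      by (rule isCont_inverse_function[of 1]) (use cont s\<theta> in auto)
    then have "isCont s \<phi>" for \<phi> by (metis \<theta>s)
    then show "continuous_on UNIV s" by (simp add: continuous_at_imp_continuous_on)
    show "surj s" using s\<theta> by (metis surjI)
    show "\<exists>r>0. velocity c (s \<phi>) = rcis r \<phi>" for \<phi>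
    proof (intro exI conjI)
      show "exp (Re (G (s \<phi>))) > 0" by simp
      show "velocity c (s \<phi>) = rcis (exp (Re (G (s \<phi>)))) \<phi>"
        using \<theta>s[of \<phi>] by (simp add: G exp_eq_polar rcis_def \<theta>_def exp_of_real)
    qed
    show "turning c (s \<phi>) (s \<psi>) = \<psi> - \<phi>" for \<phi> \<psi> by (simp add: turn \<theta>s)
    show "(s \<phi> - s \<psi>) / L \<in> \<int> \<longleftrightarrow> (\<phi> - \<psi>) / total_curvature L c \<in> \<int>" for \<phi> \<psi>
    proof -
      have "(s \<phi> - s \<psi>) / L = of_int m \<longleftrightarrow> (\<phi> - \<psi>) / D = of_int m" for m
      proof -
        have "(s \<phi> - s \<psi>) / L = of_int m \<longleftrightarrow> s \<phi> = s \<psi> + of_int m * L"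
          using L by (auto simp: field_simps)
        also have "\<dots> \<longleftrightarrow> \<theta> (s \<phi>) = \<theta> (s \<psi> + of_int m * L)"
          using inj by (simp add: inj_eq)
        also have "\<dots> \<longleftrightarrow> (\<phi> - \<psi>) / D = of_int m"
          unfolding per_int \<theta>s using \<open>D \<noteq> 0\<close> by (auto simp: field_simps)
        finally show ?thesis .
      qed
      then have "(s \<phi> - s \<psi>) / L \<in> \<int> \<longleftrightarrow> (\<phi> - \<psi>) / D \<in> \<int>"
        by (auto simp: Ints_def image_iff)
      also have "\<dots> \<longleftrightarrow> (\<phi> - \<psi>) / \<bar>D\<bar> \<in> \<int>"
        by (cases "D > 0") (auto simp: abs_if)
      finally show ?thesis by (simp add: tot)
    qed
  qed
qed

section \<open>Intersections of tangents\<close>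

text \<open>
  Cramer's rule for the intersection of the tangents at \<open>a\<close> and \<open>b\<close>; the determinant of two vectors
  \<open>u\<close> and \<open>w\<close> is \<open>Im (cnj u * w)\<close>.
\<close>

definition tangent_meet :: "(real \<Rightarrow> complex) \<Rightarrow> real \<Rightarrow> real \<Rightarrow> complex" where
  "tangent_meet c a b = c a + of_real
     (Im (cnj (velocity c b) * (c b - c a)) / Im (cnj (velocity c b) * velocity c a)) * velocity c a"

lemma tangent_line_iff:
  assumes "velocity c t \<noteq> 0"
  shows "Q \<in> tangent_line c t \<longleftrightarrow> Im (cnj (velocity c t) * (Q - c t)) = 0"
proof
  assume "Q \<in> tangent_line c t"
  then show "Im (cnj (velocity c t) * (Q - c t)) = 0"
    by (auto simp: tangent_line_def)
next
  assume "Im (cnj (velocity c t) * (Q - c t)) = 0"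
  then have "Im ((Q - c t) / velocity c t) = 0"
    by (simp add: Im_divide algebra_simps)
  then have "(Q - c t) / velocity c t = of_real (Re ((Q - c t) / velocity c t))"
    by (simp add: complex_eq_iff)
  then have "Q = c t + of_real (Re ((Q - c t) / velocity c t)) * velocity c t"
    using assms by (metis add.commute diff_add_cancel nonzero_divide_eq_eq)
  then show "Q \<in> tangent_line c t"
    unfolding tangent_line_def by blast
qed

lemma convex_tangent_line:
  assumes "velocity c t \<noteq> 0"
  shows "convex (tangent_line c t)"
proof -
  have "tangent_line c t = (\<lambda>x. c t + x) ` ((\<lambda>s. of_real s * velocity c t) ` UNIV)"
    by (auto simp: tangent_line_def)
  moreover have "linear (\<lambda>s. of_real s * velocity c t)"
    by (auto intro!: linearI simp: algebra_simps scaleR_conv_of_real)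
  ultimately show ?thesis
    by (metis convex_UNIV convex_linear_image convex_translation)
qed

lemma tangent_meet_in_tangent_lines:
  assumes "Im (cnj (velocity c b) * velocity c a) \<noteq> 0"
  shows "tangent_meet c a b \<in> tangent_line c a" and "tangent_meet c a b \<in> tangent_line c b"
proof -
  show "tangent_meet c a b \<in> tangent_line c a"
    unfolding tangent_meet_def tangent_line_def by blast
  have v: "velocity c b \<noteq> 0" using assms by auto
  define x where "x = Im (cnj (velocity c b) * (c b - c a)) / Im (cnj (velocity c b) * velocity c a)"
  have "Im (cnj (velocity c b) * (tangent_meet c a b - c b)) =
      x * Im (cnj (velocity c b) * velocity c a) - Im (cnj (velocity c b) * (c b - c a))"
    unfolding tangent_meet_def x_def[symmetric] by (simp add: algebra_simps)
  also have "\<dots> = 0" using assms by (simp add: x_def)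
  finally show "tangent_meet c a b \<in> tangent_line c b"
    by (simp only: tangent_line_iff[OF v])
qed

text \<open>
  If \<open>Q\<close> lies on every tangent, then \<open>det (c', Q - c) = 0\<close> identically. The derivative of this
  relation is \<open>det (c'', Q - c) = 0\<close>. As \<open>c'\<close> and \<open>c''\<close> are linearly independent by the
  non-vanishing of the curvature, \<open>Q = c\<close>, and the curve would be constant.
\<close>

lemma tangents_not_concurrent:
  assumes C2: "closed_C2_curve L c" and curv: "\<And>t. curvature c t \<noteq> 0"
  shows "\<exists>t. Q \<notin> tangent_line c t"
proof (rule ccontr)
  assume "\<nexists>t. Q \<notin> tangent_line c t"
  then have Q: "\<And>t. Q \<in> tangent_line c t" by blast
  have v0: "\<And>t. velocity c t \<noteq> 0" using C2 by (auto simp: closed_C2_curve_def)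
  have "c t = Q" for t
  proof -
    have "((\<lambda>t. cnj (velocity c t) * (Q - c t)) has_vector_derivative
        cnj (velocity c t) * (0 - velocity c t) + cnj (acceleration c t) * (Q - c t)) (at t)"
      by (intro has_vector_derivative_mult has_vector_derivative_diff has_vector_derivative_const
          has_vector_derivative_cnj closed_C2_curve_derivatives[OF C2])
    then have "((\<lambda>t. Im (cnj (velocity c t) * (Q - c t))) has_vector_derivative
        Im (cnj (velocity c t) * (0 - velocity c t) + cnj (acceleration c t) * (Q - c t))) (at t)"
      by (rule bounded_linear.has_vector_derivative[OF bounded_linear_Im])
    moreover have "(\<lambda>t. Im (cnj (velocity c t) * (Q - c t))) = (\<lambda>t. 0)"
      using Q tangent_line_iff[OF v0] by blast
    ultimately have "Im (cnj (velocity c t) * (0 - velocity c t) + cnj (acceleration c t) * (Q - c t)) = 0"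
      by (metis has_vector_derivative_const vector_derivative_at)
    then have 1: "Im (cnj (acceleration c t) * (Q - c t)) = 0" by simp
    obtain x where x: "Q = c t + of_real x * velocity c t"
      using Q[of t] by (auto simp: tangent_line_def)
    have "x * Im (cnj (velocity c t) * acceleration c t) = 0"
      using 1 unfolding x by (simp add: algebra_simps) argo
    moreover have "Im (cnj (velocity c t) * acceleration c t) \<noteq> 0"
      using curv[of t] by (auto simp: curvature_def simp del: mult_eq_0_iff complex_mult)
    ultimately have "x = 0"
      by (simp only: mult_eq_0_iff) simp
    then show ?thesis using x by simp
  qed
  then have "c = (\<lambda>t. Q)" by auto
  then have "velocity c 0 = 0" by (simp add: velocity_def)
  then show False using v0 by blast
qed

section \<open>The polygons\<close>

text \<open>
  Here \<open>\<rho>\<close> is the step of a polygon in units of the period. The polygon closes after \<open>n\<close> steps, by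
  minimality of \<open>n\<close> it does not meet the same point of contact before, and the two exclusions
  rule out monogons and digons.
\<close>

lemma least_multiple_in_Ints:
  fixes \<rho> :: real
  assumes "\<rho> \<in> \<rat>" and "\<rho> \<notin> \<int>" and "2 * \<rho> \<notin> \<int>"
  obtains n :: nat where "n \<ge> 3" and "real n * \<rho> \<in> \<int>"
    and "\<And>i j. i < n \<Longrightarrow> j < n \<Longrightarrow> i \<noteq> j \<Longrightarrow> (real i - real j) * \<rho> \<notin> \<int>"
proof -
  obtain p q where pq: "\<rho> = of_int p / of_nat q" "q > 0"
    using assms(1) unfolding Rats_eq_int_div_nat by auto
  define P where "P n \<longleftrightarrow> n > 0 \<and> real n * \<rho> \<in> \<int>" for n
  define n where "n = (LEAST n. P n)"
  have "P q" using pq by (auto simp: P_def)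
  then have n: "P n" unfolding n_def by (rule LeastI)
  have min: "\<not> P m" if "m < n" for m
    using that unfolding n_def by (rule not_less_Least)
  have "n \<noteq> 0" "n \<noteq> 1" "n \<noteq> 2"
    using n assms by (auto simp: P_def)
  then have "n \<ge> 3" by linarith
  moreover have "(real i - real j) * \<rho> \<notin> \<int>" if "i < n" "j < n" "j < i" for i j
    using min[of "i - j"] that by (auto simp: P_def of_nat_diff)
  moreover have "(real i - real j) * \<rho> \<in> \<int> \<longleftrightarrow> (real j - real i) * \<rho> \<in> \<int>" for i j
    by (metis minus_diff_eq minus_in_Ints_iff mult_minus_left)
  ultimately show ?thesis
    using that[of n] n unfolding P_def by (metis linorder_neqE_nat)
qed

text \<open>
  The construction for one turning angle \<open>\<beta>\<close>. The quotient of successive velocities has argument \<open>\<beta>\<close>,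
  which describes the external angle before any reduction modulo \<open>\<pi>\<close>; both notions of a pair
  with a given angle then come from the same family of polygons.
\<close>

lemma poncelet_pair_of_turning:
  assumes C2: "closed_C2_curve L c" and curv: "\<And>t. curvature c t \<noteq> 0"
    and rat: "\<beta> / total_curvature L c \<in> \<rat>"
    and not1: "\<beta> / total_curvature L c \<notin> \<int>" and not2: "2 * (\<beta> / total_curvature L c) \<notin> \<int>"
    and sin: "sin \<beta> \<noteq> 0"
  obtains K n \<P> where "closed_curve K" and "poncelet_polygons n L c K \<P>"
    and "\<And>v t j. (v, t) \<in> \<P> \<Longrightarrow> turning c (t j) (t (Suc j)) = \<beta>"
    and "\<And>v t j. (v, t) \<in> \<P> \<Longrightarrow>
           \<exists>r>0. velocity c (t (Suc j)) / velocity c (t j) = rcis r \<beta>"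
proof -
  define T where "T = total_curvature L c"
  have L: "L > 0" and v0: "\<And>t. velocity c t \<noteq> 0"
    using C2 by (auto simp: closed_C2_curve_def)
  have T0: "T \<noteq> 0" using not1 by (auto simp: T_def)
  obtain s where cs: "continuous_on UNIV s" and ss: "surj s"
    and vs: "\<And>\<phi>. \<exists>r>0. velocity c (s \<phi>) = rcis r \<phi>"
    and ts: "\<And>\<phi> \<psi>. turning c (s \<phi>) (s \<psi>) = \<psi> - \<phi>"
    and lattice: "\<And>\<phi> \<psi>. (s \<phi> - s \<psi>) / L \<in> \<int> \<longleftrightarrow> (\<phi> - \<psi>) / T \<in> \<int>"
    using angle_parametrisation[OF C2 curv] unfolding T_def by blast
  obtain n where n3: "n \<ge> 3" and nT: "real n * (\<beta> / T) \<in> \<int>"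
    and dist: "\<And>i j. i < n \<Longrightarrow> j < n \<Longrightarrow> i \<noteq> j \<Longrightarrow> (real i - real j) * (\<beta> / T) \<notin> \<int>"
    using least_multiple_in_Ints[OF rat not1 not2] unfolding T_def by metis
  define F where "F \<phi> = tangent_meet c (s \<phi>) (s (\<phi> + \<beta>))" for \<phi>
  have ratio: "\<exists>r>0. velocity c (s (\<phi> + \<beta>)) / velocity c (s \<phi>) = rcis r \<beta>" for \<phi>
  proof -
    obtain r1 r2 where "r1 > 0" "r2 > 0" "velocity c (s \<phi>) = rcis r1 \<phi>"
      "velocity c (s (\<phi> + \<beta>)) = rcis r2 (\<phi> + \<beta>)"
      using vs by meson
    then show ?thesis by (intro exI[of _ "r2 / r1"]) (simp add: rcis_divide)
  qed
  have trans: "Im (cnj (velocity c (s (\<phi> + \<beta>))) * velocity c (s \<phi>)) \<noteq> 0" for \<phi>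
  proof -
    obtain r where r: "r > 0" "velocity c (s (\<phi> + \<beta>)) / velocity c (s \<phi>) = rcis r \<beta>"
      using ratio by blast
    then have e: "velocity c (s (\<phi> + \<beta>)) = rcis r \<beta> * velocity c (s \<phi>)"
      using v0 by (simp add: field_simps)
    have "cnj (velocity c (s (\<phi> + \<beta>))) * velocity c (s \<phi>) =
        cnj (rcis r \<beta>) * of_real ((norm (velocity c (s \<phi>)))\<^sup>2)"
      unfolding e using complex_norm_square[of "velocity c (s \<phi>)"] by (simp add: mult_ac)
    then show ?thesis using r(1) sin v0 by simp
  qed
  note F_in = tangent_meet_in_tangent_lines[OF trans, folded F_def]
  have per_c: "c (t + of_int m * L) = c t" and per_v: "velocity c (t + of_int m * L) = velocity c t" for t m
  proof -
    interpret a: periodic_fun_simple c L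
      by standard (rule closed_C2_curve_periodic[OF C2])
    interpret b: periodic_fun_simple "velocity c" L
      by standard (rule closed_C2_curve_periodic[OF C2])
    show "c (t + of_int m * L) = c t" "velocity c (t + of_int m * L) = velocity c t"
      by (rule a.plus_of_int b.plus_of_int)+
  qed
  have F_per: "F \<phi> = F \<psi>" if "(\<phi> - \<psi>) / T \<in> \<int>" for \<phi> \<psi>
  proof -
    \<comment> \<open>The two parameters may be shifted by different multiples of \<open>L\<close>, which does not matter as
      \<open>tangent_meet\<close> is periodic in each of them.\<close>
    have same: "c a = c b \<and> velocity c a = velocity c b" if "(a - b) / L \<in> \<int>" for a b
    proof -
      obtain m where "(a - b) / L = of_int m" using \<open>(a - b) / L \<in> \<int>\<close> by (auto elim: Ints_cases)
      then have "a = b + of_int m * L" using L by (simp add: field_simps)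
      then show ?thesis by (simp add: per_c per_v)
    qed
    have "(s \<phi> - s \<psi>) / L \<in> \<int>" "(s (\<phi> + \<beta>) - s (\<psi> + \<beta>)) / L \<in> \<int>"
      using that lattice by auto
    then show ?thesis
      unfolding F_def tangent_meet_def by (metis same)
  qed
  have contc: "continuous_on UNIV c" and contv: "continuous_on UNIV (velocity c)"
    using closed_C2_curve_derivatives[OF C2]
    by (auto intro!: continuous_at_imp_continuous_on intro: has_vector_derivative_continuous)
  have contF: "continuous_on UNIV F"
    unfolding F_def[abs_def] tangent_meet_def
    by (intro continuous_intros continuous_on_compose2[OF contc] continuous_on_compose2[OF contv]
        continuous_on_compose2[OF cs]) (use trans in auto)
  define K where "K x = F (T * x)" for x
  have image: "F \<phi> \<in> path_image K" for \<phi>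
  proof -
    have "(\<phi> - T * frac (\<phi> / T)) / T = of_int \<lfloor>\<phi> / T\<rfloor>"
      using T0 by (simp add: frac_def field_simps)
    then have "F \<phi> = K (frac (\<phi> / T))"
      unfolding K_def by (intro F_per) simp
    moreover have "frac (\<phi> / T) \<in> {0..1}"
      using frac_lt_1[of "\<phi> / T"] by (simp add: frac_ge_0 less_imp_le)
    ultimately show ?thesis by (auto simp: path_image_def)
  qed
  have "closed_curve K"
    unfolding closed_curve_def
  proof (intro conjI)
    show "path K"
      unfolding path_def K_def[abs_def]
      by (intro continuous_on_compose2[OF contF] continuous_intros) auto
    show "pathfinish K = pathstart K"
      unfolding pathfinish_def pathstart_def K_def using T0 by (intro F_per) simp
    show "\<not> K constant_on {0..1}"
    proof
      assume "K constant_on {0..1}"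
      then obtain Q where "\<And>y. y \<in> path_image K \<Longrightarrow> y = Q"
        unfolding constant_on_def path_image_def by blast
      then have "F \<phi> = Q" for \<phi> using image by blast
      then have "Q \<in> tangent_line c (s \<phi>)" for \<phi> using F_in(1) by metis
      then have "Q \<in> tangent_line c t" for t using ss by (metis surjD)
      then show False using tangents_not_concurrent[OF C2 curv] by blast
    qed
  qed
  \<comment> \<open>\<open>F \<phi>\<close> lies on the tangents at \<open>\<phi>\<close> and \<open>\<phi> + \<beta>\<close>. The shift by one makes the vertices \<open>j\<close>
    and \<open>j + 1\<close> the two ends of the side on the tangent \<open>j\<close>.\<close>
  define v where "v \<phi> j = F (\<phi> + (real j - 1) * \<beta>)" for \<phi> j
  define t where "t \<phi> j = s (\<phi> + real j * \<beta>)" for \<phi> j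
  have t_Suc: "t \<phi> (Suc j) = s ((\<phi> + real j * \<beta>) + \<beta>)" for \<phi> j
    by (simp add: t_def algebra_simps)
  define \<P> where "\<P> = range (\<lambda>\<phi>. (v \<phi>, t \<phi>))"
  have circ: "circumscribed_ngon n L c (v \<phi>, t \<phi>)" for \<phi>
    unfolding circumscribed_ngon_def prod.case
  proof (intro conjI allI impI)
    show "n \<ge> 3" by fact
    show "v \<phi> (j + n) = v \<phi> j" for j
      unfolding v_def using nT by (intro F_per) (simp add: algebra_simps)
    show "(t \<phi> (j + n) - t \<phi> j) / L \<in> \<int>" for j
      unfolding t_def lattice using nT by (simp add: algebra_simps)
    show "(t \<phi> i - t \<phi> j) / L \<notin> \<int>" if "i < n" "j < n" "i \<noteq> j" for i j
      unfolding t_def lattice using dist[OF that] by (simp add: algebra_simps diff_divide_distrib)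
    show "closed_segment (v \<phi> j) (v \<phi> (Suc j)) \<subseteq> tangent_line c (t \<phi> j)" for j
    proof (rule closed_segment_subset)
      show "v \<phi> j \<in> tangent_line c (t \<phi> j)"
        using F_in(2)[of "\<phi> + (real j - 1) * \<beta>"] by (simp add: v_def t_def algebra_simps)
      show "v \<phi> (Suc j) \<in> tangent_line c (t \<phi> j)"
        using F_in(1)[of "\<phi> + real j * \<beta>"] by (simp add: v_def t_def)
      show "convex (tangent_line c (t \<phi> j))" by (rule convex_tangent_line[OF v0])
    qed
  qed
  show ?thesis
  proof
    show "closed_curve K" by fact
    show "poncelet_polygons n L c K \<P>"
      unfolding poncelet_polygons_def
    proof (intro conjI ballI)
      show "inscribed K P" "circumscribed_ngon n L c P" if "P \<in> \<P>" for P
        using that circ image by (auto simp: \<P>_def inscribed_def v_def)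
      fix Q assume "Q \<in> path_image K"
      then obtain \<phi> where "Q = F \<phi>" by (auto simp: path_image_def K_def)
      then have "Q = v \<phi> 1" by (simp add: v_def)
      then show "\<exists>(v, t)\<in>\<P>. Q \<in> range v" by (auto simp: \<P>_def)
    qed
    fix v' t' j assume "(v', t') \<in> \<P>"
    then obtain \<phi> where \<phi>: "t' = t \<phi>" by (auto simp: \<P>_def)
    show "turning c (t' j) (t' (Suc j)) = \<beta>"
      unfolding \<phi> t_Suc by (simp add: t_def ts)
    show "\<exists>r>0. velocity c (t' (Suc j)) / velocity c (t' j) = rcis r \<beta>"
      unfolding \<phi> t_Suc using ratio by (simp add: t_def)
  qed
qed

lemma has_external_angle_rcis:
  assumes "r > 0" and "w / u = rcis r (\<alpha> + of_int i * pi)"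
  shows "has_external_angle u w \<alpha>"
proof -
  define z where "z = Complex (ln r) (\<alpha> + of_int i * pi)"
  have "w / u = exp z"
    using assms by (simp add: z_def exp_eq_polar rcis_def exp_of_real)
  moreover obtain k where "Im z - of_int k * (2 * pi) = Arg (exp z)"
    using Arg_exp_diff_2pi by blast
  ultimately have "Arg (w / u) = \<alpha> + of_int (i - 2 * k) * pi"
    by (simp add: z_def algebra_simps)
  then show ?thesis unfolding has_external_angle_def by blast
qed

theorem theorem6:
  fixes c :: "real \<Rightarrow> complex" and L \<alpha> :: real and k :: nat
  assumes "closed_C2_curve L c"
    and "\<And>t. curvature c t \<noteq> 0"
    and "k > 0" and "total_curvature L c = 2 * real k * pi"
    and "0 < \<alpha>" and "\<alpha> < pi" and "\<alpha> / pi \<in> \<rat>"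
  shows "\<exists>K :: nat \<Rightarrow> real \<Rightarrow> complex. \<forall>i<2 * k.
           closed_curve (K i) \<and>
           equiangular_poncelet_pair L c (K i) \<alpha> \<and>
           poncelet_pair_with_turning L c (K i) (\<alpha> + real i * pi)"
proof -
  have "\<exists>K. closed_curve K \<and> equiangular_poncelet_pair L c K \<alpha> \<and>
      poncelet_pair_with_turning L c K (\<alpha> + real i * pi)" for i :: nat
  proof -
    define \<beta> where "\<beta> = \<alpha> + real i * pi"
    define \<rho> where "\<rho> = \<beta> / total_curvature L c"
    \<comment> \<open>This excludes parallel tangents as well as polygons with fewer than three vertices.\<close>
    have \<alpha>_not: "\<alpha> \<noteq> of_int m * pi" for m
    proof
      assume "\<alpha> = of_int m * pi"
      then have "0 < m" "m < 1" using assms(5,6) by (auto simp: zero_less_mult_iff)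
      then show False by simp
    qed
    have \<rho>: "\<rho> = (\<alpha> / pi + real i) / (2 * real k)"
      using \<open>k > 0\<close> by (simp add: \<rho>_def \<beta>_def assms(4) field_simps)
    have not2: "2 * \<rho> \<notin> \<int>"
    proof
      assume "2 * \<rho> \<in> \<int>"
      then obtain m where "2 * \<rho> = of_int m" by (auto elim: Ints_cases)
      then have "\<alpha> = of_int (m * int k - int i) * pi"
        using \<open>k > 0\<close> by (simp add: \<rho> field_simps)
      then show False using \<alpha>_not by blast
    qed
    have not1: "\<rho> \<notin> \<int>"
      using not2 Ints_mult[of 2 \<rho>] by auto
    have "\<rho> \<in> \<rat>" unfolding \<rho> using assms(7) by auto
    moreover have "sin \<beta> \<noteq> 0"
    proof
      assume "sin \<beta> = 0"
      then obtain m where "\<beta> = of_int m * pi" by (auto simp: sin_zero_iff_int2)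
      then have "\<alpha> = of_int (m - int i) * pi" by (simp add: \<beta>_def algebra_simps)
      then show False using \<alpha>_not by blast
    qed
    ultimately obtain K n \<P> where K: "closed_curve K" and P: "poncelet_polygons n L c K \<P>"
      and turn: "\<And>v t j. (v, t) \<in> \<P> \<Longrightarrow> turning c (t j) (t (Suc j)) = \<beta>"
      and ratio: "\<And>v t j. (v, t) \<in> \<P> \<Longrightarrow>
           \<exists>r>0. velocity c (t (Suc j)) / velocity c (t j) = rcis r \<beta>"
      using poncelet_pair_of_turning[OF assms(1,2), of \<beta>] not1 not2 unfolding \<rho>_def by metis
    have "has_external_angle (velocity c (t j)) (velocity c (t (Suc j))) \<alpha>"
      if "(v, t) \<in> \<P>" for v t j
      using ratio[OF that, of j] has_external_angle_rcis[where i = "int i"] by (auto simp: \<beta>_def)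
    then have "equiangular_poncelet_pair L c K \<alpha>"
      unfolding equiangular_poncelet_pair_def using P by blast
    moreover have "poncelet_pair_with_turning L c K \<beta>"
      unfolding poncelet_pair_with_turning_def using P turn by blast
    ultimately show ?thesis using K unfolding \<beta>_def by blast
  qed
  then show ?thesis by metis
qed

end
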